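(* Let $X,Y$ be complete metric spaces and $E,F$ nonzero normed spaces over $\mathbb K$. If $T:C_u^*(X,E)\to C_u^*(Y,F)$ is a biseparating map, then $X$ and $Y$ are uniformly homeomorphic, that is, there exists a (surjective) homeomorphism $h:Y\to X$ such that both $h$ and $h^{-1}$ are uniformly continuous.
   Context: $\mathbb K=\mathbb R$ or $\mathbb C$. $C_u^*(X,E)$ is the space of uniformly continuous bounded functions $X\to E$. For $f:X\to E$, $c(f):=\{x\in X:f(x)\neq0\}$. A map $T:C_u^*(X,E)\to C_u^*(Y,F)$ is separating if it is additive and $c(Tf)\cap c(Tg)=\emptyset$ whenever $c(f)\cap c(g)=\emptyset$; it is biseparating if it is bijective and both $T$ and $T^{-1}$ are separating. Linearity is not assumed. *)

theory Defs
  imports "HOL-Analysis.Analysis"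
begin

text \<open>
  A normed space over a scalar field \<open>'k\<close>, which may be \<^typ>\<open>real\<close> or \<^typ>\<open>complex\<close>. The class
  \<^class>\<open>real_normed_vector\<close> supplies the additive group, the norm and the metric; the scalar
  multiplication over \<open>'k\<close> is the parameter \<open>scale\<close>. On real scalars \<open>scale\<close> agrees with
  \<^const>\<open>scaleR\<close>: it is additive and continuous in the scalar.
\<close>

locale normed_space = vector_space scale
  for scale :: "'k::real_normed_field \<Rightarrow> 'e::real_normed_vector \<Rightarrow> 'e" +
  assumes norm_scale: "norm (scale a v) = norm a * norm v"

lemma normed_space_real: "normed_space (scaleR :: real \<Rightarrow> 'e::real_normed_vector \<Rightarrow> 'e)"
  by unfold_locales (auto simp: algebra_simps)

lemma normed_space_complex: "normed_space ((*) :: complex \<Rightarrow> complex \<Rightarrow> complex)"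
  by unfold_locales (auto simp: algebra_simps norm_mult)

text \<open>
  Metric spaces are sets \<open>X\<close> in an ambient metric type. A function \<open>X \<rightarrow> E\<close> is represented by its
  extension by zero to the whole type, so that functions are equal iff they agree on \<open>X\<close>. The
  extension need not be continuous on the ambient type.
\<close>

definition Cub :: "'a::metric_space set \<Rightarrow> ('a \<Rightarrow> 'e::real_normed_vector) set" where
  "Cub X = {f. uniformly_continuous_on X f \<and> bounded (f ` X) \<and> (\<forall>x. x \<notin> X \<longrightarrow> f x = 0)}"

text \<open>The cozero set \<open>c(f)\<close> is \<^const>\<open>support_on\<close>, which takes no closure.\<close>

definition separating ::
    "'a::metric_space set \<Rightarrow> 'b::metric_space set \<Rightarrow>
     (('a \<Rightarrow> 'e::real_normed_vector) \<Rightarrow> ('b \<Rightarrow> 'f::real_normed_vector)) \<Rightarrow> bool" where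
  "separating X Y T \<longleftrightarrow>
     T \<in> Cub X \<rightarrow> Cub Y \<and>
     (\<forall>f\<in>Cub X. \<forall>g\<in>Cub X. T (\<lambda>x. f x + g x) = (\<lambda>y. T f y + T g y)) \<and>
     (\<forall>f\<in>Cub X. \<forall>g\<in>Cub X. support_on X f \<inter> support_on X g = {} \<longrightarrow> support_on Y (T f) \<inter> support_on Y (T g) = {})"

definition biseparating ::
    "'a::metric_space set \<Rightarrow> 'b::metric_space set \<Rightarrow>
     (('a \<Rightarrow> 'e::real_normed_vector) \<Rightarrow> ('b \<Rightarrow> 'f::real_normed_vector)) \<Rightarrow> bool" where
  "biseparating X Y T \<longleftrightarrow>
     bij_betw T (Cub X) (Cub Y) \<and> separating X Y T \<and> separating Y X (inv_into (Cub X) T)"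

definition uniformly_homeomorphic :: "'a::metric_space set \<Rightarrow> 'b::metric_space set \<Rightarrow> bool" where
  "uniformly_homeomorphic X Y \<longleftrightarrow>
     (\<exists>h k. homeomorphism Y X h k \<and> uniformly_continuous_on Y h \<and> uniformly_continuous_on X k)"

end

theory Submission
  imports Defs "HOL-Library.Ramsey"
begin

text \<open>
  Two supports are at positive distance iff every \<open>f\<close> admits a \<open>g\<close> agreeing with \<open>f\<close> on the first
  and vanishing on the second: multiply \<open>f\<close> by a Urysohn function in one direction, take \<open>f\<close>
  constant in the other. This condition is phrased through differences and disjointness of supports
  only, so \<open>T\<close> and its inverse preserve it. Thus \<open>T\<close> induces a correspondence between open subsets
  of \<open>X\<close> and \<open>Y\<close> that preserves disjointness and positive distance. By Efremovich's lemma such a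
  correspondence sends sets of small diameter to sets of small diameter, uniformly. Completeness then
  turns the images of shrinking balls into points, and the resulting map is uniformly continuous in
  both directions.
\<close>

section \<open>Efremovich's lemma\<close>

text \<open>Distances between points are used instead of \<open>infdist\<close>, so the empty set is
  far from every set.\<close>

definition far :: "'a::metric_space set \<Rightarrow> 'a set \<Rightarrow> bool" where
  "far A B \<longleftrightarrow> (\<exists>d>0. \<forall>a\<in>A. \<forall>b\<in>B. d \<le> dist a b)"

text \<open>Colour each pair of indices by which of its two cross distances is short, if any, and
  apply Ramsey's theorem. On a homogeneous set a short colour would join some \<open>a j\<close> to
  \<open>b j\<close> by three short steps, so no cross distance is short.\<close>

lemma Efremovich:
  fixes a b :: "nat \<Rightarrow> 'a::metric_space"
  assumes ab: "\<And>n. \<epsilon> \<le> dist (a n) (b n)" and "0 < \<epsilon>"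
  obtains H where "infinite H" "\<And>i j. i \<in> H \<Longrightarrow> j \<in> H \<Longrightarrow> \<epsilon> / 4 \<le> dist (a i) (b j)"
proof -
  \<comment> \<open>Ramsey's theorem colours unordered pairs; \<open>Min\<close> and
    \<open>Max\<close> recover the order of the two indices.\<close>
  define col :: "nat set \<Rightarrow> nat" where
    "col S = (if dist (a (Min S)) (b (Max S)) < \<epsilon> / 4 then 0
              else if dist (a (Max S)) (b (Min S)) < \<epsilon> / 4 then 1 else 2)" for S
  have "\<forall>x\<in>UNIV. \<forall>y\<in>UNIV. x \<noteq> y \<longrightarrow> col {x, y} < 3"
    by (simp add: col_def)
  from Ramsey2[OF infinite_UNIV_nat this] obtain H t where
    "infinite H \<and> t < 3 \<and> (\<forall>x\<in>H. \<forall>y\<in>H. x \<noteq> y \<longrightarrow> col {x, y} = t)"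
    by (elim exE conjE) simp
  then have H: "infinite H" and "t < 3"
    and t: "\<And>x y. x \<in> H \<Longrightarrow> y \<in> H \<Longrightarrow> x \<noteq> y \<Longrightarrow> col {x, y} = t"
    by simp_all
  have lt: "t = 0 \<Longrightarrow> dist (a i) (b j) < \<epsilon> / 4" "t = 1 \<Longrightarrow> dist (a j) (b i) < \<epsilon> / 4"
    "t = 2 \<Longrightarrow> \<epsilon> / 4 \<le> dist (a i) (b j)" "t = 2 \<Longrightarrow> \<epsilon> / 4 \<le> dist (a j) (b i)"
    if "i \<in> H" "j \<in> H" "i < j" for i j
  proof -
    have ends: "Min {i, j} = i" "Max {i, j} = j" using that by simp_all
    have "t = col {i, j}" using t[of i j] that by simp
    then have "t = (if dist (a i) (b j) < \<epsilon> / 4 then 0 else if dist (a j) (b i) < \<epsilon> / 4 then 1 else 2)"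
      unfolding col_def ends .
    then show "t = 0 \<Longrightarrow> dist (a i) (b j) < \<epsilon> / 4" "t = 1 \<Longrightarrow> dist (a j) (b i) < \<epsilon> / 4"
      "t = 2 \<Longrightarrow> \<epsilon> / 4 \<le> dist (a i) (b j)" "t = 2 \<Longrightarrow> \<epsilon> / 4 \<le> dist (a j) (b i)"
      by (cases "dist (a i) (b j) < \<epsilon> / 4"; cases "dist (a j) (b i) < \<epsilon> / 4"; simp)+
  qed
  obtain i where "i \<in> H" using H by (metis finite.emptyI equals0I)
  obtain j where "j \<in> H" "i < j" using H unfolding infinite_nat_iff_unbounded by blast
  obtain k where "k \<in> H" "j < k" using H unfolding infinite_nat_iff_unbounded by blast
  note ij = lt[OF \<open>i \<in> H\<close> \<open>j \<in> H\<close> \<open>i < j\<close>] and jk = lt[OF \<open>j \<in> H\<close> \<open>k \<in> H\<close> \<open>j < k\<close>]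
    and ik = lt[OF \<open>i \<in> H\<close> \<open>k \<in> H\<close> less_trans[OF \<open>i < j\<close> \<open>j < k\<close>]]
  have "t \<noteq> 0"
  proof
    assume "t = 0"
    \<comment> \<open>The path \<open>a j\<close>, \<open>b k\<close>, \<open>a i\<close>,
      \<open>b j\<close> is shorter than three quarters of \<open>\<epsilon>\<close>.\<close>
    then have "dist (a i) (b j) < \<epsilon> / 4" "dist (a j) (b k) < \<epsilon> / 4" "dist (a i) (b k) < \<epsilon> / 4"
      using ij(1) jk(1) ik(1) by blast+
    then show False using ab[of j] \<open>0 < \<epsilon>\<close>
      dist_triangle[of "a j" "b j" "b k"] dist_triangle2[of "b k" "b j" "a i"]
      by (simp add: dist_commute)
  qed
  moreover have "t \<noteq> 1"
  proof
    assume "t = 1"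
    \<comment> \<open>Now the path is \<open>a j\<close>, \<open>b i\<close>, \<open>a k\<close>,
      \<open>b j\<close>.\<close>
    then have "dist (a j) (b i) < \<epsilon> / 4" "dist (a k) (b j) < \<epsilon> / 4" "dist (a k) (b i) < \<epsilon> / 4"
      using ij(2) jk(2) ik(2) by blast+
    then show False using ab[of j] \<open>0 < \<epsilon>\<close>
      dist_triangle[of "a j" "b j" "b i"] dist_triangle2[of "b i" "b j" "a k"]
      by (simp add: dist_commute)
  qed
  ultimately have "t = 2" using \<open>t < 3\<close> by linarith
  have "\<epsilon> / 4 \<le> dist (a m) (b n)" if "m \<in> H" "n \<in> H" for m n
  proof (cases m n rule: linorder_cases)
    case equal
    then show ?thesis using ab[of m] \<open>0 < \<epsilon>\<close> by simp
  next
    case less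
    then show ?thesis using lt(3)[OF that less] \<open>t = 2\<close> by blast
  next
    case greater
    then show ?thesis using lt(4)[OF that(2,1) greater] \<open>t = 2\<close> by blast
  qed
  with H show ?thesis by (rule that)
qed

section \<open>Correspondences of open sets\<close>

text \<open>\<open>\<Phi> U\<close> stands for the cozero set of the image of some function with
  cozero set \<open>U\<close>. That function is an arbitrary choice, so neither monotonicity nor
  mutual inverseness is assumed; the disjointness equivalence takes their place.\<close>

locale far_correspondence =
  fixes X :: "'a::metric_space set" and Y :: "'b::metric_space set"
    and \<Phi> :: "'a set \<Rightarrow> 'b set" and \<Psi> :: "'b set \<Rightarrow> 'a set"
  assumes open_\<Phi>: "openin (top_of_set X) U \<Longrightarrow> openin (top_of_set Y) (\<Phi> U)"
    and open_\<Psi>: "openin (top_of_set Y) V \<Longrightarrow> openin (top_of_set X) (\<Psi> V)"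
    and \<Phi>_disjoint_iff: "openin (top_of_set X) U \<Longrightarrow> openin (top_of_set Y) V \<Longrightarrow>
      \<Phi> U \<inter> V = {} \<longleftrightarrow> \<Psi> V \<inter> U = {}"
    and \<Phi>_nonempty: "openin (top_of_set X) U \<Longrightarrow> U \<noteq> {} \<Longrightarrow> \<Phi> U \<noteq> {}"
    and \<Psi>_nonempty: "openin (top_of_set Y) V \<Longrightarrow> V \<noteq> {} \<Longrightarrow> \<Psi> V \<noteq> {}"
    and far_\<Phi>: "openin (top_of_set X) U \<Longrightarrow> openin (top_of_set X) U' \<Longrightarrow> far U U' \<Longrightarrow> far (\<Phi> U) (\<Phi> U')"
    and far_\<Psi>: "openin (top_of_set Y) V \<Longrightarrow> openin (top_of_set Y) V' \<Longrightarrow> far V V' \<Longrightarrow> far (\<Psi> V) (\<Psi> V')"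
begin

lemma swap: "far_correspondence Y X \<Psi> \<Phi>"
  by unfold_locales
    (simp_all add: open_\<Phi> open_\<Psi> \<Phi>_disjoint_iff \<Phi>_nonempty \<Psi>_nonempty far_\<Phi> far_\<Psi>)

text \<open>Meeting \<open>V\<close> after \<open>\<Phi>\<close> is the same as meeting the fixed
  set \<open>\<Psi> V\<close> before it, and the latter is monotone in \<open>U\<close>.\<close>

lemma \<Phi>_meets_mono:
  assumes "openin (top_of_set X) U" "openin (top_of_set X) U'" "openin (top_of_set Y) V" "U \<subseteq> U'"
    and "\<Phi> U \<inter> V \<noteq> {}"
  shows "\<Phi> U' \<inter> V \<noteq> {}"
  using assms(4,5)
  unfolding \<Phi>_disjoint_iff[OF assms(1,3)] \<Phi>_disjoint_iff[OF assms(2,3)] by blast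

text \<open>Otherwise sets \<open>U n\<close> of diameter tending to 0 have images containing points
  \<open>a n\<close>, \<open>b n\<close> at distance at least \<open>\<epsilon>\<close>.
  Efremovich's lemma yields far open sets \<open>V\<close>, \<open>W\<close> around infinitely many
  of these points. Then \<open>\<Psi> V\<close> and \<open>\<Psi> W\<close> are far, yet both meet
  arbitrarily small \<open>U n\<close>.\<close>

lemma small_diameter:
  assumes "0 < \<epsilon>"
  obtains \<delta> where "0 < \<delta>"
    "\<And>U v w. openin (top_of_set X) U \<Longrightarrow> (\<And>p q. p \<in> U \<Longrightarrow> q \<in> U \<Longrightarrow> dist p q < \<delta>) \<Longrightarrow>
      v \<in> \<Phi> U \<Longrightarrow> w \<in> \<Phi> U \<Longrightarrow> dist v w < \<epsilon>"
proof (rule ccontr)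
  assume contr: "\<not> thesis"
  have "\<exists>U v w. openin (top_of_set X) U \<and> (\<forall>p\<in>U. \<forall>q\<in>U. dist p q < 1 / real (Suc n)) \<and>
      v \<in> \<Phi> U \<and> w \<in> \<Phi> U \<and> \<epsilon> \<le> dist v w" for n
  proof (rule ccontr)
    assume "\<not> ?thesis"
    then have "thesis"
      by (intro that[of "1 / real (Suc n)"]) (simp, meson not_le)
    with contr show False by blast
  qed
  then obtain U a b where U: "\<And>n. openin (top_of_set X) (U n)"
    and Ud: "\<And>n p q. p \<in> U n \<Longrightarrow> q \<in> U n \<Longrightarrow> dist p q < 1 / real (Suc n)"
    and a: "\<And>n. a n \<in> \<Phi> (U n)" and b: "\<And>n. b n \<in> \<Phi> (U n)"
    and ab: "\<And>n. \<epsilon> \<le> dist (a n) (b n)"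
    by metis
  obtain H where H: "infinite H" and sep: "\<And>i j. i \<in> H \<Longrightarrow> j \<in> H \<Longrightarrow> \<epsilon> / 4 \<le> dist (a i) (b j)"
    by (rule Efremovich[of \<epsilon> a b, OF ab assms]) blast
  \<comment> \<open>The two radii together cost \<open>\<epsilon> / 8\<close> of the separation
    \<open>\<epsilon> / 4\<close>. Intersecting with \<open>\<Phi> (U i)\<close> keeps the union
    relatively open in \<open>Y\<close>.\<close>
  define V where "V = (\<Union>i\<in>H. \<Phi> (U i) \<inter> ball (a i) (\<epsilon> / 16))"
  define W where "W = (\<Union>i\<in>H. \<Phi> (U i) \<inter> ball (b i) (\<epsilon> / 16))"
  have V: "openin (top_of_set Y) V" and W: "openin (top_of_set Y) W"
    unfolding V_def W_def by (auto intro!: openin_Union openin_Int_open open_\<Phi> U)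
  have "far V W"
    unfolding far_def
  proof (intro exI conjI ballI)
    show "\<epsilon> / 8 > 0" using assms by simp
    fix v w assume "v \<in> V" "w \<in> W"
    then obtain i j where "i \<in> H" "j \<in> H" "dist (a i) v < \<epsilon> / 16" "dist (b j) w < \<epsilon> / 16"
      unfolding V_def W_def by auto
    with sep[of i j] show "\<epsilon> / 8 \<le> dist v w"
      using dist_triangle[of "a i" "b j" v] dist_triangle[of v "b j" w]
      by (simp add: dist_commute)
  qed
  from far_\<Psi>[OF V W this] obtain d where "0 < d"
    and d: "\<And>p q. p \<in> \<Psi> V \<Longrightarrow> q \<in> \<Psi> W \<Longrightarrow> d \<le> dist p q"
    unfolding far_def by blast
  obtain m where m: "1 / real (Suc m) < d"
    using \<open>0 < d\<close> nat_approx_posE by blast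
  obtain n where "n \<in> H" "m < n" using H unfolding infinite_nat_iff_unbounded by blast
  have "a n \<in> V" "b n \<in> W" using a[of n] b[of n] \<open>n \<in> H\<close> assms unfolding V_def W_def
    by (auto intro!: bexI[of _ n])
  \<comment> \<open>The point \<open>a n\<close> witnesses that \<open>\<Phi> (U n)\<close> meets
    \<open>V\<close>, and \<open>b n\<close> that it meets \<open>W\<close>; the disjointness
    equivalence moves both facts to \<open>X\<close>.\<close>
  then have "\<Psi> V \<inter> U n \<noteq> {}" "\<Psi> W \<inter> U n \<noteq> {}"
    using a[of n] b[of n] \<Phi>_disjoint_iff[OF U V] \<Phi>_disjoint_iff[OF U W] by blast+
  then obtain p q where "p \<in> \<Psi> V" "q \<in> \<Psi> W" "p \<in> U n" "q \<in> U n" by blast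
  then have "d < 1 / real (Suc n)" using d Ud by (meson order_le_less_trans)
  moreover have "1 / real (Suc n) \<le> 1 / real (Suc m)"
    using \<open>m < n\<close> by (simp add: frac_le)
  ultimately show False using m by linarith
qed

text \<open>A relation instead of a map: it is unchanged when the two spaces are exchanged, and
  existence and uniqueness of partners can be proved separately.\<close>

definition corresponds :: "'a \<Rightarrow> 'b \<Rightarrow> bool" where
  "corresponds x y \<longleftrightarrow> x \<in> X \<and> y \<in> Y \<and>
    (\<forall>U V. openin (top_of_set X) U \<longrightarrow> openin (top_of_set Y) V \<longrightarrow> x \<in> U \<longrightarrow> y \<in> V \<longrightarrow>
      \<Phi> U \<inter> V \<noteq> {})"

text \<open>A small ball around \<open>x\<close> contains \<open>x'\<close> too, so its image comes
  close to both \<open>y\<close> and \<open>y'\<close>, and that image has small diameter. The case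
  \<open>x = x'\<close> gives uniqueness of partners, the general case uniform continuity.\<close>

lemma corresponds_uniform:
  assumes "0 < \<epsilon>"
  obtains \<delta> where "0 < \<delta>"
    "\<And>x y x' y'. corresponds x y \<Longrightarrow> corresponds x' y' \<Longrightarrow> dist x x' < \<delta> \<Longrightarrow> dist y y' < \<epsilon>"
proof -
  from assms have "0 < \<epsilon> / 3" by simp
  then obtain \<delta> where "0 < \<delta>" and \<delta>: "\<And>U v w. openin (top_of_set X) U \<Longrightarrow>
      (\<And>p q. p \<in> U \<Longrightarrow> q \<in> U \<Longrightarrow> dist p q < \<delta>) \<Longrightarrow> v \<in> \<Phi> U \<Longrightarrow> w \<in> \<Phi> U \<Longrightarrow> dist v w < \<epsilon> / 3"
    using small_diameter by metis
  have "dist y y' < \<epsilon>" if c: "corresponds x y" "corresponds x' y'" and xx: "dist x x' < \<delta> / 2" for x y x' y'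
  proof -
    let ?U = "X \<inter> ball x (\<delta> / 2)"
    have U: "openin (top_of_set X) ?U" "x \<in> ?U" "x' \<in> ?U"
      using c xx \<open>0 < \<delta>\<close> by (auto simp: corresponds_def openin_open_Int)
    have "\<Phi> ?U \<inter> (Y \<inter> ball z (\<epsilon> / 3)) \<noteq> {}" if "corresponds t z" "t \<in> ?U" for t z
    proof -
      have "openin (top_of_set Y) (Y \<inter> ball z (\<epsilon> / 3))" "z \<in> Y \<inter> ball z (\<epsilon> / 3)"
        using that(1) \<open>0 < \<epsilon>\<close> by (auto simp: openin_open_Int corresponds_def)
      with that U(1) show ?thesis unfolding corresponds_def by blast
    qed
    from this[OF c(1) U(2)] this[OF c(2) U(3)] obtain v w
      where vw: "v \<in> \<Phi> ?U" "w \<in> \<Phi> ?U" and d: "dist y v < \<epsilon> / 3" "dist y' w < \<epsilon> / 3" by auto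
    have "dist p q < \<delta>" if "p \<in> ?U" "q \<in> ?U" for p q
      using that dist_triangle_half_r[of x p \<delta> q] by simp
    from \<delta>[OF U(1) this vw] d show ?thesis
      using dist_triangle[of y y' v] dist_triangle[of v y' w] by (simp add: dist_commute)
  qed
  then show ?thesis using \<open>0 < \<delta>\<close> that[of "\<delta> / 2"] by simp
qed

text \<open>Points picked from the images of balls shrinking to \<open>x\<close> form a Cauchy
  sequence by \<open>small_diameter\<close>; its limit is the partner of \<open>x\<close>.\<close>

lemma corresponds_total:
  assumes "complete Y" "x \<in> X"
  obtains y where "corresponds x y"
proof -
  define U where "U n = X \<inter> ball x (1 / real (Suc n))" for n
  have U: "openin (top_of_set X) (U n)" "x \<in> U n" for n
    using assms by (auto simp: U_def openin_open_Int)
  have mono: "U m \<subseteq> U n" if "n \<le> m" for m n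
  proof -
    have "1 / real (Suc m) \<le> 1 / real (Suc n)"
      using that by (simp add: frac_le)
    then show ?thesis unfolding U_def by auto
  qed
  have "\<exists>y. y \<in> \<Phi> (U n)" for n using \<Phi>_nonempty[of "U n"] U by blast
  then obtain y where y: "\<And>n. y n \<in> \<Phi> (U n)" by metis
  have yY: "y n \<in> Y" for n using y open_\<Phi>[OF U(1)] openin_imp_subset by blast
  have "Cauchy y"
  proof (rule metric_CauchyI)
    fix \<epsilon> :: real assume "0 < \<epsilon>"
    then have "0 < \<epsilon> / 3" by simp
    then obtain \<delta> where "0 < \<delta>" and \<delta>: "\<And>U v w. openin (top_of_set X) U \<Longrightarrow>
        (\<And>p q. p \<in> U \<Longrightarrow> q \<in> U \<Longrightarrow> dist p q < \<delta>) \<Longrightarrow> v \<in> \<Phi> U \<Longrightarrow> w \<in> \<Phi> U \<Longrightarrow> dist v w < \<epsilon> / 3"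
      using small_diameter by metis
    obtain N where N: "1 / real (Suc N) < \<delta> / 2"
      using \<open>0 < \<delta>\<close> nat_approx_posE[of "\<delta> / 2"] by auto
    \<comment> \<open>The images need not be nested, so \<open>y n\<close> may lie outside
      \<open>\<Phi> (U N)\<close>. Monotonicity of meeting, applied to a ball around
      \<open>y n\<close>, still puts it near that set.\<close>
    have close: "\<exists>v\<in>\<Phi> (U N). dist (y n) v < \<epsilon> / 3" if "n \<ge> N" for n
    proof -
      have "\<Phi> (U n) \<inter> (Y \<inter> ball (y n) (\<epsilon> / 3)) \<noteq> {}"
        using y[of n] yY[of n] centre_in_ball[of "y n" "\<epsilon> / 3"] \<open>0 < \<epsilon>\<close> by auto
      then have "\<Phi> (U N) \<inter> (Y \<inter> ball (y n) (\<epsilon> / 3)) \<noteq> {}"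
        using \<Phi>_meets_mono[OF U(1) U(1) _ mono[OF that]] by (simp add: openin_open_Int)
      then show ?thesis by auto
    qed
    have diam: "dist p q < \<delta>" if "p \<in> U N" "q \<in> U N" for p q
      using that N dist_triangle_half_r[of x p \<delta> q] unfolding U_def by simp
    have "dist (y m) (y n) < \<epsilon>" if mn: "m \<ge> N" "n \<ge> N" for m n
    proof -
      obtain v w where "v \<in> \<Phi> (U N)" "w \<in> \<Phi> (U N)" and "dist (y m) v < \<epsilon> / 3" "dist (y n) w < \<epsilon> / 3"
        using close mn by blast
      with \<delta>[OF U(1) diam, of N v w] show ?thesis
        using dist_triangle[of "y m" "y n" v] dist_triangle[of v "y n" w] by (simp add: dist_commute)
    qed
    then show "\<exists>M. \<forall>m\<ge>M. \<forall>n\<ge>M. dist (y m) (y n) < \<epsilon>" by blast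
  qed
  with assms(1) yY obtain l where l: "l \<in> Y" "y \<longlonglongrightarrow> l" by (auto elim!: completeE[of _ y])
  have "corresponds x l"
    unfolding corresponds_def
  proof (intro conjI allI impI)
    fix G V assume G: "openin (top_of_set X) G" and V: "openin (top_of_set Y) V" and xl: "x \<in> G" "l \<in> V"
    obtain e where "0 < e" "ball x e \<inter> X \<subseteq> G" using G xl unfolding openin_contains_ball by blast
    moreover obtain N where "1 / real (Suc N) < e" using \<open>0 < e\<close> nat_approx_posE by blast
    ultimately have N: "U N \<subseteq> G" unfolding U_def by auto
    obtain V' where V': "open V'" "V = Y \<inter> V'" using V by (auto simp: openin_open)
    have "eventually (\<lambda>n. y n \<in> V') sequentially"
      using l V' xl by (auto intro: topological_tendstoD)
    then obtain M where "\<And>n. n \<ge> M \<Longrightarrow> y n \<in> V'" unfolding eventually_sequentially by blast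
    \<comment> \<open>Index at least \<open>M\<close> puts the point into \<open>V\<close>; index at
      least \<open>N\<close> puts the ball inside \<open>G\<close>.\<close>
    then have "y (max M N) \<in> V" using yY V' by simp
    then have "\<Phi> (U (max M N)) \<inter> V \<noteq> {}" using y by blast
    then show "\<Phi> G \<inter> V \<noteq> {}"
      using \<Phi>_meets_mono[OF U(1) G V] mono[of N "max M N"] N by auto
  qed (use assms l in auto)
  with that show ?thesis .
qed

text \<open>Totality and uniqueness in both directions make \<open>corresponds\<close> the graph of
  a bijection, and the two uniform estimates are its uniform continuity in both directions.\<close>

theorem uniformly_homeomorphic:
  assumes "complete X" "complete Y"
  shows "uniformly_homeomorphic X Y"
proof -
  interpret swap: far_correspondence Y X \<Psi> \<Phi> by (rule swap)
  have corresponds_swap: "swap.corresponds y x \<longleftrightarrow> corresponds x y" for x y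
    by (auto simp: corresponds_def swap.corresponds_def \<Phi>_disjoint_iff)
  have functional: "y = y'" if "corresponds x y" "corresponds x y'" for x y y'
  proof (rule ccontr)
    assume "y \<noteq> y'"
    then obtain \<delta> where "0 < \<delta>" "\<And>a b a' b'. corresponds a b \<Longrightarrow> corresponds a' b' \<Longrightarrow>
        dist a a' < \<delta> \<Longrightarrow> dist b b' < dist y y'"
      using corresponds_uniform[of "dist y y'"] by auto
    with that show False by fastforce
  qed
  have inj: "x = x'" if "corresponds x y" "corresponds x' y" for x x' y
  proof (rule ccontr)
    assume "x \<noteq> x'"
    then obtain \<delta> where "0 < \<delta>" "\<And>a b a' b'. corresponds b a \<Longrightarrow> corresponds b' a' \<Longrightarrow>
        dist a a' < \<delta> \<Longrightarrow> dist b b' < dist x x'"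
      using swap.corresponds_uniform[of "dist x x'"] unfolding corresponds_swap by auto
    with that show False by fastforce
  qed
  have "\<exists>x. corresponds x y" if "y \<in> Y" for y
    using swap.corresponds_total[OF assms(1) that] corresponds_swap by blast
  then obtain h where h: "\<And>y. y \<in> Y \<Longrightarrow> corresponds (h y) y" by metis
  have "\<exists>y. corresponds x y" if "x \<in> X" for x
    using corresponds_total[OF assms(2) that] by blast
  then obtain k where k: "\<And>x. x \<in> X \<Longrightarrow> corresponds x (k x)" by metis
  have hX: "h y \<in> X" if "y \<in> Y" for y using h[OF that] by (simp add: corresponds_def)
  have kY: "k x \<in> Y" if "x \<in> X" for x using k[OF that] by (simp add: corresponds_def)
  have uh: "uniformly_continuous_on Y h"
    unfolding uniformly_continuous_on_def
  proof (intro allI impI)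
    fix \<epsilon> :: real assume "0 < \<epsilon>"
    from swap.corresponds_uniform[OF this] obtain \<delta> where "0 < \<delta>" "\<And>a b a' b'. corresponds b a \<Longrightarrow>
        corresponds b' a' \<Longrightarrow> dist a a' < \<delta> \<Longrightarrow> dist b b' < \<epsilon>"
      unfolding corresponds_swap by blast
    then show "\<exists>\<delta>>0. \<forall>y\<in>Y. \<forall>y'\<in>Y. dist y' y < \<delta> \<longrightarrow> dist (h y') (h y) < \<epsilon>"
      using h by blast
  qed
  have uk: "uniformly_continuous_on X k"
    unfolding uniformly_continuous_on_def
  proof (intro allI impI)
    fix \<epsilon> :: real assume "0 < \<epsilon>"
    from corresponds_uniform[OF this] obtain \<delta> where "0 < \<delta>" "\<And>a b a' b'. corresponds a b \<Longrightarrow>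
        corresponds a' b' \<Longrightarrow> dist a a' < \<delta> \<Longrightarrow> dist b b' < \<epsilon>"
      by blast
    then show "\<exists>\<delta>>0. \<forall>x\<in>X. \<forall>x'\<in>X. dist x' x < \<delta> \<longrightarrow> dist (k x') (k x) < \<epsilon>"
      using k by blast
  qed
  have "k (h y) = y" if "y \<in> Y" for y
    by (rule functional[OF k[OF hX[OF that]] h[OF that]])
  moreover have "h (k x) = x" if "x \<in> X" for x
    by (rule inj[OF h[OF kY[OF that]] k[OF that]])
  ultimately have "homeomorphism Y X h k"
    by (intro homeomorphismI) (use uh uk hX kY in \<open>auto intro: uniformly_continuous_imp_continuous\<close>)
  with uh uk show ?thesis unfolding uniformly_homeomorphic_def by blast
qed

end

section \<open>Uniformly continuous bounded functions\<close>

text \<open>The case distinction is needed because \<open>infdist x {} = 0\<close>.\<close>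

definition cutoff :: "real \<Rightarrow> 'a::metric_space set \<Rightarrow> 'a \<Rightarrow> real" where
  "cutoff c S x = (if S = {} then 1 else min 1 (infdist x S / c))"

lemma cutoff_bounds:
  assumes "0 < c"
  shows "0 \<le> cutoff c S x" "cutoff c S x \<le> 1"
  using assms by (simp_all add: cutoff_def infdist_nonneg)

lemma cutoff_lipschitz:
  assumes "0 < c"
  shows "\<bar>cutoff c S x - cutoff c S y\<bar> \<le> dist x y / c"
proof (cases "S = {}")
  case False
  have "\<bar>cutoff c S x - cutoff c S y\<bar> \<le> \<bar>infdist x S / c - infdist y S / c\<bar>"
    using False by (auto simp: cutoff_def)
  also have "\<dots> = \<bar>infdist x S - infdist y S\<bar> / c"
    using assms by (simp flip: diff_divide_distrib)
  also have "\<dots> \<le> dist x y / c"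
    using assms by (simp add: divide_right_mono infdist_triangle_abs)
  finally show ?thesis .
qed (use assms in \<open>simp add: cutoff_def\<close>)

lemma CubI:
  assumes "uniformly_continuous_on X f" "bounded (f ` X)" "\<And>x. x \<notin> X \<Longrightarrow> f x = 0"
  shows "f \<in> Cub X"
  using assms by (simp add: Cub_def)

lemma Cub_const: "(\<lambda>x. if x \<in> X then u else 0) \<in> Cub X"
proof (rule CubI)
  show "uniformly_continuous_on X (\<lambda>x. if x \<in> X then u else 0)"
    by (auto simp: uniformly_continuous_on_def intro: exI[of _ 1])
  show "bounded ((\<lambda>x. if x \<in> X then u else 0) ` X)"
    by (rule bounded_subset[of "{u}"]) auto
qed auto

lemma Cub_diff:
  assumes "f \<in> Cub X" "g \<in> Cub X"
  shows "(\<lambda>x. f x - g x) \<in> Cub X"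
  using assms by (intro CubI uniformly_continuous_on_diff bounded_minus_comp) (simp_all add: Cub_def)

text \<open>In the product estimate the variation of the Lipschitz factor is multiplied by
  \<open>f\<close>, which is controlled by a bound \<open>B\<close> for \<open>f\<close>.\<close>

lemma Cub_cutoff:
  assumes f: "f \<in> Cub X" and c: "0 < c"
  shows "(\<lambda>x. cutoff c S x *\<^sub>R f x) \<in> Cub X"
proof (rule CubI)
  obtain B where "0 < B" and B: "\<And>x. x \<in> X \<Longrightarrow> norm (f x) \<le> B"
    using f unfolding Cub_def bounded_pos by auto
  have "norm (cutoff c S x *\<^sub>R f x) \<le> B" if "x \<in> X" for x
    using cutoff_bounds[OF c, of S x] B[OF that] mult_left_le_one_le[of "norm (f x)" "cutoff c S x"]
    by simp
  then show "bounded ((\<lambda>x. cutoff c S x *\<^sub>R f x) ` X)"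
    by (intro boundedI[of _ B]) blast
  have uf: "uniformly_continuous_on X f" using f by (simp add: Cub_def)
  show "uniformly_continuous_on X (\<lambda>x. cutoff c S x *\<^sub>R f x)"
    unfolding uniformly_continuous_on_def
  proof (intro allI impI)
    fix e :: real assume "0 < e"
    then have "0 < e / 2" by simp
    with uf obtain d where "0 < d" and d: "\<And>x y. x \<in> X \<Longrightarrow> y \<in> X \<Longrightarrow> dist y x < d \<Longrightarrow> dist (f y) (f x) < e / 2"
      unfolding uniformly_continuous_on_def by metis
    \<comment> \<open>The second term of the minimum makes the Lipschitz bound times
      \<open>B\<close> less than \<open>e / 2\<close>.\<close>
    have "dist (cutoff c S y *\<^sub>R f y) (cutoff c S x *\<^sub>R f x) < e"
      if "x \<in> X" "y \<in> X" "dist y x < min d (e * c / (2 * B))" for x y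
    proof -
      have "norm ((cutoff c S y - cutoff c S x) *\<^sub>R f x) \<le> dist y x / c * B"
        unfolding norm_scaleR using cutoff_lipschitz[OF c, of S y x] B[OF that(1)] c
        by (intro mult_mono) simp_all
      also have "\<dots> < e / 2"
        using that(3) c \<open>0 < B\<close> by (simp add: field_simps)
      finally have 1: "norm ((cutoff c S y - cutoff c S x) *\<^sub>R f x) < e / 2" .
      have 2: "norm (cutoff c S y *\<^sub>R (f y - f x)) < e / 2"
        using cutoff_bounds[OF c, of S y] d[OF that(1,2)] that(3)
          mult_left_le_one_le[of "norm (f y - f x)" "cutoff c S y"]
        by (simp add: dist_norm)
      have "cutoff c S y *\<^sub>R f y - cutoff c S x *\<^sub>R f x
          = cutoff c S y *\<^sub>R (f y - f x) + (cutoff c S y - cutoff c S x) *\<^sub>R f x"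
        by (simp add: algebra_simps)
      then show ?thesis unfolding dist_norm using norm_triangle_lt[of "cutoff c S y *\<^sub>R (f y - f x)"] 1 2
        by (smt (verit) field_sum_of_halves)
    qed
    then show "\<exists>d>0. \<forall>x\<in>X. \<forall>x'\<in>X. dist x' x < d \<longrightarrow>
        dist (cutoff c S x' *\<^sub>R f x') (cutoff c S x *\<^sub>R f x) < e"
      using \<open>0 < d\<close> \<open>0 < e\<close> \<open>0 < B\<close> c by (intro exI[of _ "min d (e * c / (2 * B))"]) simp
  qed
qed (use f in \<open>simp add: Cub_def\<close>)

lemma openin_support_on:
  assumes "f \<in> Cub X"
  shows "openin (top_of_set X) (support_on X f)"
proof -
  have "continuous_on X f" using assms by (simp add: Cub_def uniformly_continuous_imp_continuous)
  from continuous_openin_preimage_gen[OF this open_Compl[OF closed_singleton[of 0]]] show ?thesis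
    by (simp add: support_on_def vimage_def Int_def)
qed

text \<open>For an ambient open \<open>G\<close>, the cutoff at the complement vanishes exactly off
  \<open>G\<close>; if \<open>G\<close> is the whole type, the cutoff is constantly 1. Multiplying
  by the constant \<open>u\<close> gives \<open>f\<close>.\<close>

lemma Cub_support_exists:
  fixes u :: "'e::real_normed_vector"
  assumes "openin (top_of_set X) U" "u \<noteq> 0"
  obtains f where "f \<in> Cub X" and "support_on X (f :: 'a::metric_space \<Rightarrow> 'e) = U"
proof -
  obtain G where G: "open G" "U = X \<inter> G" using assms(1) by (auto simp: openin_open)
  have "cutoff 1 (- G) x \<noteq> 0 \<longleftrightarrow> x \<in> G" for x
    using G in_closed_iff_infdist_zero[of "- G" x] infdist_nonneg[of x "- G"]
    by (auto simp: cutoff_def min_def)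
  then have "support_on X (\<lambda>x. cutoff 1 (- G) x *\<^sub>R (if x \<in> X then u else 0)) = U"
    using assms(2) G by (auto simp: support_on_def)
  then show ?thesis
    using that[OF Cub_cutoff[OF Cub_const, of 1]] by simp
qed

lemma far_support_iff:
  fixes k l :: "'a::metric_space \<Rightarrow> 'e::real_normed_vector"
  assumes u: "(u::'e) \<noteq> 0"
  shows "far (support_on X k) (support_on X l) \<longleftrightarrow>
    (\<forall>f\<in>Cub X. \<exists>g\<in>Cub X. support_on X (\<lambda>x. f x - g x) \<inter> support_on X k = {} \<and>
      support_on X (g :: 'a \<Rightarrow> 'e) \<inter> support_on X l = {})" (is "far ?A ?B \<longleftrightarrow> ?R")
proof
  assume "far ?A ?B"
  then obtain d where "0 < d" and d: "\<And>a b. a \<in> ?A \<Longrightarrow> b \<in> ?B \<Longrightarrow> d \<le> dist a b"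
    unfolding far_def by blast
  \<comment> \<open>The cutoff with scale \<open>d\<close> serves as the Urysohn function: 1 on the
    first support, 0 on the second.\<close>
  have A: "cutoff d ?B x = 1" if "x \<in> ?A" for x
  proof (cases "?B = {}")
    case False
    then have "d \<le> infdist x ?B" using d[OF that] by (simp add: infdist_def cINF_greatest)
    then show ?thesis using \<open>0 < d\<close> by (simp add: cutoff_def)
  qed (simp add: cutoff_def)
  have B: "cutoff d ?B x = 0" if "x \<in> ?B" for x
    using that by (auto simp: cutoff_def)
  show ?R
  proof
    fix f :: "'a \<Rightarrow> 'e" assume "f \<in> Cub X"
    from Cub_cutoff[OF this \<open>0 < d\<close>, of ?B] show "\<exists>g\<in>Cub X.
        support_on X (\<lambda>x. f x - g x) \<inter> ?A = {} \<and> support_on X g \<inter> ?B = {}"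
      by (rule bexI[rotated]) (use A B in \<open>auto simp: support_on_def\<close>)
  qed
next
  assume ?R
  from bspec[OF this Cub_const[of X u]] obtain g where g: "g \<in> Cub X"
    and A: "support_on X (\<lambda>x. (if x \<in> X then u else 0) - g x) \<inter> ?A = {}"
    and B: "support_on X g \<inter> ?B = {}"
    by blast
  have gA: "g x = u" if "x \<in> ?A" for x using A that by (auto simp: support_on_def)
  have gB: "g x = 0" if "x \<in> ?B" for x using B that by (auto simp: support_on_def)
  have "uniformly_continuous_on X g" "0 < norm u" using g u by (simp_all add: Cub_def)
  then obtain d where "0 < d"
    and d: "\<And>x y. x \<in> X \<Longrightarrow> y \<in> X \<Longrightarrow> dist y x < d \<Longrightarrow> dist (g y) (g x) < norm u"
    unfolding uniformly_continuous_on_def by metis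
  have "d \<le> dist a b" if "a \<in> ?A" "b \<in> ?B" for a b
  proof -
    have "a \<in> X" "b \<in> X" using that by (simp_all add: support_on_def)
    \<comment> \<open>If \<open>a\<close> and \<open>b\<close> were closer than \<open>d\<close>,
      the values \<open>u\<close> and 0 of \<open>g\<close> would differ by less than
      \<open>norm u\<close>.\<close>
    then show ?thesis using d[of b a] gA[OF that(1)] gB[OF that(2)] by fastforce
  qed
  with \<open>0 < d\<close> show "far ?A ?B" unfolding far_def by blast
qed

section \<open>Biseparating maps\<close>

lemma separating_Cub: "separating X Y T \<Longrightarrow> f \<in> Cub X \<Longrightarrow> T f \<in> Cub Y"
  unfolding separating_def by blast

lemma separating_support:
  "separating X Y T \<Longrightarrow> f \<in> Cub X \<Longrightarrow> g \<in> Cub X \<Longrightarrow> support_on X f \<inter> support_on X g = {} \<Longrightarrow>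
    support_on Y (T f) \<inter> support_on Y (T g) = {}"
  unfolding separating_def by blast

text \<open>Additivity is applied to \<open>f\<close> written as the sum of \<open>f - g\<close> and
  \<open>g\<close>.\<close>

lemma separating_diff:
  assumes T: "separating X Y T" and f: "f \<in> Cub X" and g: "g \<in> Cub X"
  shows "T (\<lambda>x. f x - g x) = (\<lambda>y. T f y - T g y)"
proof -
  have "\<forall>f\<in>Cub X. \<forall>g\<in>Cub X. T (\<lambda>x. f x + g x) = (\<lambda>y. T f y + T g y)"
    using T by (simp add: separating_def)
  from bspec[OF bspec[OF this Cub_diff[OF f g]] g] have "T f = (\<lambda>y. T (\<lambda>x. f x - g x) y + T g y)"
    by simp
  then show ?thesis by simp
qed

text \<open>The criterion \<open>far_support_iff\<close> is transported: pull \<open>f\<close> back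
  by \<open>S\<close>, take the function \<open>g\<close> that the criterion provides in
  \<open>X\<close>, and push it forward. Additivity turns the image of \<open>S f - g\<close> into
  \<open>f - T g\<close>.\<close>

lemma separating_far:
  fixes T :: "('a::metric_space \<Rightarrow> 'e::real_normed_vector) \<Rightarrow> ('b::metric_space \<Rightarrow> 'f::real_normed_vector)"
  assumes T: "separating X Y T" and S: "separating Y X S"
    and TS: "\<And>g. g \<in> Cub Y \<Longrightarrow> T (S g) = g"
    and u: "(u::'e) \<noteq> 0" and v: "(v::'f) \<noteq> 0" and k: "k \<in> Cub X" and l: "l \<in> Cub X"
    and far: "far (support_on X k) (support_on X l)"
  shows "far (support_on Y (T k)) (support_on Y (T l))"
  unfolding far_support_iff[OF v]
proof
  fix f :: "'b \<Rightarrow> 'f" assume f: "f \<in> Cub Y"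
  have Sf: "S f \<in> Cub X" by (rule separating_Cub[OF S f])
  from bspec[OF iffD1[OF far_support_iff[OF u] far] Sf]
  obtain g where g: "g \<in> Cub X" "support_on X (\<lambda>x. S f x - g x) \<inter> support_on X k = {}"
      "support_on X g \<inter> support_on X l = {}"
    by blast
  have "T (\<lambda>x. S f x - g x) = (\<lambda>y. f y - T g y)"
    using separating_diff[OF T Sf g(1)] TS[OF f] by simp
  then have "support_on Y (\<lambda>y. f y - T g y) \<inter> support_on Y (T k) = {}"
    using separating_support[OF T Cub_diff[OF Sf g(1)] k g(2)] by simp
  then show "\<exists>g\<in>Cub Y. support_on Y (\<lambda>x. f x - g x) \<inter> support_on Y (T k) = {} \<and>
      support_on Y g \<inter> support_on Y (T l) = {}"
    using separating_Cub[OF T g(1)] separating_support[OF T g(1) l g(3)] by (intro bexI[of _ "T g"] conjI)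
qed

text \<open>A set is empty iff it is disjoint from itself, so \<open>S\<close> preserves emptiness
  of supports.\<close>

lemma separating_nonempty:
  assumes T: "separating X Y T" and S: "separating Y X S"
    and ST: "S (T k) = k" and k: "k \<in> Cub X" and ne: "support_on X k \<noteq> {}"
  shows "support_on Y (T k) \<noteq> {}"
proof
  assume "support_on Y (T k) = {}"
  then have "support_on X (S (T k)) \<inter> support_on X (S (T k)) = {}"
    using separating_support[OF S separating_Cub[OF T k] separating_Cub[OF T k]] by simp
  with ST ne show False by simp
qed

text \<open>One direction applies \<open>S\<close> to the pair \<open>T k\<close>, \<open>l\<close>;
  the other applies \<open>T\<close> to the pair \<open>S l\<close>, \<open>k\<close>.\<close>

lemma separating_disjoint_iff:
  assumes T: "separating X Y T" and S: "separating Y X S"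
    and TS: "T (S l) = l" and ST: "S (T k) = k" and k: "k \<in> Cub X" and l: "l \<in> Cub Y"
  shows "support_on Y (T k) \<inter> support_on Y l = {} \<longleftrightarrow> support_on X (S l) \<inter> support_on X k = {}"
proof
  assume "support_on Y (T k) \<inter> support_on Y l = {}"
  from separating_support[OF S separating_Cub[OF T k] l this]
  show "support_on X (S l) \<inter> support_on X k = {}" by (simp add: ST Int_commute)
next
  assume "support_on X (S l) \<inter> support_on X k = {}"
  from separating_support[OF T separating_Cub[OF S l] k this]
  show "support_on Y (T k) \<inter> support_on Y l = {}" by (simp add: TS Int_commute)
qed

theorem corollary3p3:
  fixes X :: "'a::metric_space set" and Y :: "'b::metric_space set"
    and scaleE :: "'k::real_normed_field \<Rightarrow> 'e::real_normed_vector \<Rightarrow> 'e"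
    and scaleF :: "'k \<Rightarrow> 'f::real_normed_vector \<Rightarrow> 'f"
    and T :: "('a \<Rightarrow> 'e) \<Rightarrow> ('b \<Rightarrow> 'f)"
  assumes "complete X" and "complete Y"
    and "normed_space scaleE" and "normed_space scaleF"
    and "\<exists>u::'e. u \<noteq> 0" and "\<exists>v::'f. v \<noteq> 0"
    and "biseparating X Y T"
  shows "uniformly_homeomorphic X Y"
proof -
  obtain u :: 'e and v :: 'f where u: "u \<noteq> 0" and v: "v \<noteq> 0" using assms(5,6) by blast
  define S where "S = inv_into (Cub X) T"
  have bij: "bij_betw T (Cub X) (Cub Y)" and T: "separating X Y T" and S: "separating Y X S"
    using assms(7) by (auto simp: biseparating_def S_def)
  have ST: "S (T f) = f" if "f \<in> Cub X" for f
    using bij_betw_inv_into_left[OF bij that] by (simp add: S_def)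
  have TS: "T (S g) = g" if "g \<in> Cub Y" for g
    using bij_betw_inv_into_right[OF bij that] by (simp add: S_def)
  \<comment> \<open>One function is fixed for each open set, so that the correspondence becomes an
    actual map on open sets.\<close>
  have "\<exists>f. f \<in> Cub X \<and> support_on X (f :: 'a \<Rightarrow> 'e) = U" if "openin (top_of_set X) U" for U
    using Cub_support_exists[OF that u] by blast
  then obtain p :: "'a set \<Rightarrow> 'a \<Rightarrow> 'e" where p: "\<And>U. openin (top_of_set X) U \<Longrightarrow> p U \<in> Cub X"
      "\<And>U. openin (top_of_set X) U \<Longrightarrow> support_on X (p U) = U"
    by metis
  have "\<exists>f. f \<in> Cub Y \<and> support_on Y (f :: 'b \<Rightarrow> 'f) = V" if "openin (top_of_set Y) V" for V
    using Cub_support_exists[OF that v] by blast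
  then obtain q :: "'b set \<Rightarrow> 'b \<Rightarrow> 'f" where q: "\<And>V. openin (top_of_set Y) V \<Longrightarrow> q V \<in> Cub Y"
      "\<And>V. openin (top_of_set Y) V \<Longrightarrow> support_on Y (q V) = V"
    by metis
  have "far_correspondence X Y (\<lambda>U. support_on Y (T (p U))) (\<lambda>V. support_on X (S (q V)))"
  proof
    fix U assume U: "openin (top_of_set X) U"
    show "openin (top_of_set Y) (support_on Y (T (p U)))"
      by (rule openin_support_on[OF separating_Cub[OF T p(1)[OF U]]])
    show "support_on Y (T (p U)) \<noteq> {}" if "U \<noteq> {}"
      using separating_nonempty[OF T S ST p(1)[OF U]] p[OF U] that by simp
    show "support_on Y (T (p U)) \<inter> V = {} \<longleftrightarrow> support_on X (S (q V)) \<inter> U = {}"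
      if "openin (top_of_set Y) V" for V
      using separating_disjoint_iff[OF T S _ _ p(1)[OF U] q(1)[OF that]] TS ST p U q that by simp
    show "far (support_on Y (T (p U))) (support_on Y (T (p U')))"
      if "openin (top_of_set X) U'" "far U U'" for U'
      using separating_far[OF T S TS u v p(1)[OF U] p(1)[OF that(1)]] p(2)[OF U] p(2)[OF that(1)] that(2)
      by simp
  next
    fix V assume V: "openin (top_of_set Y) V"
    show "openin (top_of_set X) (support_on X (S (q V)))"
      by (rule openin_support_on[OF separating_Cub[OF S q(1)[OF V]]])
    show "support_on X (S (q V)) \<noteq> {}" if "V \<noteq> {}"
      using separating_nonempty[OF S T TS q(1)[OF V]] q[OF V] that by simp
    show "far (support_on X (S (q V))) (support_on X (S (q V')))"
      if "openin (top_of_set Y) V'" "far V V'" for V'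
      using separating_far[OF S T ST v u q(1)[OF V] q(1)[OF that(1)]] q(2)[OF V] q(2)[OF that(1)] that(2)
      by simp
  qed
  then show ?thesis
    using far_correspondence.uniformly_homeomorphic assms(1,2) by blast
qed

end
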